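(* The generating function for the number of spanning trees in the family $\mathcal{P}_4=\{P_n^4 : n\ge 6\}$ is, as a formal power series, $$\sum_{m=0}^{\infty}\tau(P_{m+6}^4)\,t^m=\frac{M_4}{(t^{6} - 3t^{5} + 6t^{4} - 10t^{3} + 6t^{2} - 3t + 1)(t^{8} - 4t^{7} - 17t^{6} + 8t^{5} + 49t^{4} + 8t^{3} - 17t^{2} - 4t + 1)},$$ where \begin{align*} M_4&=-125t^{13} + 859t^{12} - 13t^{11} - 3141t^{10} + 3475t^9 - 5968t^8 - 11312t^7 \\ &+ 36080t^6 - 5597t^5 - 7893t^4 + 2435t^3 - 2741t^2 - 413t + 864. \end{align*}
   Context: All graphs are finite and simple. $P_n$ is the path graph on $n$ vertices. For a graph $G$ and $k\ge1$, the $k$-th power $G^k$ has $V(G^k)=V(G)$, and $uv$ is an edge iff the distance between $u$ and $v$ in $G$ is at least $1$ and at most $k$. $\tau(G)$ is the number of labeled spanning trees of $G$ (isomorphic trees with different labels are counted as different). The family is $\mathcal{P}_k=\{P_n^k : k<\operatorname{diam} P_n\}=\{P_n^k : n\ge k+2\}$; the sequence is indexed so that the constant term of the generating function corresponds to the smallest member $n=k+2$. *)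

theory Defs
  imports "HOL-Library.Extended_Nat" "HOL-Computational_Algebra.Formal_Power_Series"
begin

record 'a sgraph =
  vertices :: "'a set"
  edges :: "'a set set"

definition simple_graph :: "'a sgraph \<Rightarrow> bool" where
  "simple_graph G \<longleftrightarrow> finite (vertices G) \<and>
     edges G \<subseteq> {{u, v} | u v. u \<in> vertices G \<and> v \<in> vertices G \<and> u \<noteq> v}"

text \<open>Walks are nonempty vertex lists; a walk \<open>p\<close> has \<open>length p - 1\<close> edges.\<close>

definition walk_betw :: "'a sgraph \<Rightarrow> 'a \<Rightarrow> 'a list \<Rightarrow> 'a \<Rightarrow> bool" where
  "walk_betw G u p v \<longleftrightarrow> p \<noteq> [] \<and> hd p = u \<and> last p = v \<and> set p \<subseteq> vertices G \<and>
     (\<forall>i. Suc i < length p \<longrightarrow> {p ! i, p ! Suc i} \<in> edges G)"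

text \<open>The distance is \<open>\<infinity>\<close>, the infimum of the empty set, if no walk joins the two vertices.\<close>

definition graph_distance :: "'a sgraph \<Rightarrow> 'a \<Rightarrow> 'a \<Rightarrow> enat" where
  "graph_distance G u v = (INF p \<in> {p. walk_betw G u p v}. enat (length p - 1))"

definition graph_power :: "'a sgraph \<Rightarrow> nat \<Rightarrow> 'a sgraph" where
  "graph_power G k = \<lparr> vertices = vertices G,
     edges = {{u, v} | u v. u \<in> vertices G \<and> v \<in> vertices G \<and>
                1 \<le> graph_distance G u v \<and> graph_distance G u v \<le> enat k} \<rparr>"

definition path_graph :: "nat \<Rightarrow> nat sgraph" where
  "path_graph n = \<lparr> vertices = {0..<n}, edges = {{i, Suc i} | i. Suc i < n} \<rparr>"

definition connected_graph :: "'a sgraph \<Rightarrow> bool" where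
  "connected_graph G \<longleftrightarrow> vertices G \<noteq> {} \<and>
     (\<forall>u \<in> vertices G. \<forall>v \<in> vertices G. \<exists>p. walk_betw G u p v)"

text \<open>A cycle is listed without repeating its initial vertex at the end.\<close>

definition graph_cycle :: "'a sgraph \<Rightarrow> 'a list \<Rightarrow> bool" where
  "graph_cycle G c \<longleftrightarrow> 3 \<le> length c \<and> distinct c \<and>
     walk_betw G (hd c) c (last c) \<and> {last c, hd c} \<in> edges G"

definition tree_graph :: "'a sgraph \<Rightarrow> bool" where
  "tree_graph T \<longleftrightarrow> simple_graph T \<and> connected_graph T \<and> (\<nexists>c. graph_cycle T c)"

definition spanning_trees :: "'a sgraph \<Rightarrow> 'a sgraph set" where
  "spanning_trees G =
     {T. vertices T = vertices G \<and> edges T \<subseteq> edges G \<and> tree_graph T}"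

definition num_spanning_trees :: "'a sgraph \<Rightarrow> nat" where
  "num_spanning_trees G = card (spanning_trees G)"

end

theory Submission
  imports Defs
begin

text \<open>The spanning trees are counted by a transfer matrix that sweeps over the vertices from the last one
downwards. For a set partition of the last four vertices of \<open>P\<^sub>n\<^sup>4\<close>, count the edge sets that become a
spanning tree when the vertices in each block are identified; the number of spanning trees is the
value at the partition into singletons. Deleting or contracting, one after the other, the four edges
from the last vertex to its predecessors (\<open>deletion_contraction\<close>), and then removing this vertex,
expresses the numbers for \<open>n + 1\<close> vertices by those for \<open>n\<close> vertices, with coefficients that do not
depend on \<open>n\<close>: the last vertex must have been identified with another one, as it would be isolated
otherwise, and so it can be dropped (\<open>frontier_trees_slide\<close>). The 15 partitions thus give a vector
that evolves by a constant \<open>15 \<times> 15\<close> matrix (\<open>state_vector_Suc\<close>).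

The product of the two factors of the denominator, as a polynomial in this matrix, sends the unit row
vector of the partition into singletons not to \<open>0\<close> but to 50 times the difference ``sum over the three
partitions of type 2+2 minus sum over the four partitions of type 3+1'' (\<open>recurrence_orbit\<close>). This
difference is zero for every graph with four marked vertices. Seen from these vertices, the graph is an
electrical network with six conductances; up to a common factor, the count for a partition
into two blocks is the total conductance between the blocks, and each conductance occurs twice in
either sum. For the counts at hand it is enough that the difference is a left eigenvector
with eigenvalue 1 and vanishes at \<open>n = 4\<close> (\<open>balance_zero\<close>). So the denominator
describes a recurrence of order 14, which the counts satisfy, and the numerator
follows from the first 14 counts.

The passage from trees, defined by walks and cycles, to a notion that behaves well under
contraction rests on one fact: an edge set is a tree iff it is connected and has one edge less than there
are vertices (\<open>tree_graph_iff_card\<close>). Connectedness is expressed by cuts, that is, by two-valued functions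
that are constant along edges, and contraction by a labelling of the vertices whose fibres are
the identified vertices.\<close>

section \<open>Deletion and contraction\<close>

definition vertex_pairs :: "'a set \<Rightarrow> 'a set set" where
  "vertex_pairs V = {{u, v} | u v. u \<in> V \<and> v \<in> V \<and> u \<noteq> v}"

text \<open>Connectedness after identifying the vertices with equal labels. The truth values of \<open>g\<close> are the
two sides of a cut, and a cut that no edge crosses and that splits no fibre of \<open>c\<close> has to be trivial. In this form
an edge between \<open>u\<close> and \<open>v\<close> and an equality \<open>c u = c v\<close> impose the same condition on \<open>g\<close>, which is all that
contraction needs.\<close>

definition joins :: "'a set \<Rightarrow> ('a \<Rightarrow> 'b) \<Rightarrow> 'a set set \<Rightarrow> bool" where
  "joins V c F \<longleftrightarrow>
     (\<forall>g :: 'a \<Rightarrow> bool.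
        (\<forall>x\<in>V. \<forall>y\<in>V. c x = c y \<longrightarrow> g x = g y) \<longrightarrow>
        (\<forall>e\<in>F. \<forall>x\<in>e. \<forall>y\<in>e. g x = g y) \<longrightarrow>
        (\<forall>x\<in>V. \<forall>y\<in>V. g x = g y))"

definition merge :: "('a \<Rightarrow> 'b) \<Rightarrow> 'a \<Rightarrow> 'a \<Rightarrow> 'a \<Rightarrow> 'b" where
  "merge c u v = (\<lambda>x. if c x = c u then c v else c x)"

lemma joinsI:
  assumes "\<And>g x y. \<lbrakk>\<And>x y. \<lbrakk>x \<in> V; y \<in> V; c x = c y\<rbrakk> \<Longrightarrow> g x = g y;
      \<And>e x y. \<lbrakk>e \<in> F; x \<in> e; y \<in> e\<rbrakk> \<Longrightarrow> g x = g y; x \<in> V; y \<in> V\<rbrakk> \<Longrightarrow> (g x :: bool) = g y"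
  shows "joins V c F"
  unfolding joins_def
proof (intro allI impI ballI)
  fix g :: "'a \<Rightarrow> bool" and x y
  assume "\<forall>x\<in>V. \<forall>y\<in>V. c x = c y \<longrightarrow> g x = g y" "\<forall>e\<in>F. \<forall>x\<in>e. \<forall>y\<in>e. g x = g y" "x \<in> V" "y \<in> V"
  then show "g x = g y" by (intro assms[of g x y]) blast+
qed

lemma joinsD:
  assumes "joins V c F"
    and "\<And>x y. \<lbrakk>x \<in> V; y \<in> V; c x = c y\<rbrakk> \<Longrightarrow> g x = g y"
    and "\<And>e x y. \<lbrakk>e \<in> F; x \<in> e; y \<in> e\<rbrakk> \<Longrightarrow> g x = g y"
    and "x \<in> V" "y \<in> V"
  shows "(g x :: bool) = g y"
proof -
  have "\<forall>x\<in>V. \<forall>y\<in>V. c x = c y \<longrightarrow> g x = g y" "\<forall>e\<in>F. \<forall>x\<in>e. \<forall>y\<in>e. g x = g y"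
    using assms(2,3) by blast+
  then show ?thesis using assms(1,4,5) unfolding joins_def by blast
qed

lemma joins_insert:
  assumes "u \<in> V" "v \<in> V"
  shows "joins V c (insert {u, v} F) \<longleftrightarrow> joins V (merge c u v) F"
proof -
  have "(\<forall>x\<in>V. \<forall>y\<in>V. merge c u v x = merge c u v y \<longrightarrow> g x = g y) \<longleftrightarrow>
      (\<forall>x\<in>V. \<forall>y\<in>V. c x = c y \<longrightarrow> g x = g y) \<and> g u = g v" for g :: "'a \<Rightarrow> bool"
  proof (rule iffI; (intro conjI ballI impI)?)
    assume L: "\<forall>x\<in>V. \<forall>y\<in>V. merge c u v x = merge c u v y \<longrightarrow> g x = g y"
    show "g x = g y" if "x \<in> V" "y \<in> V" "c x = c y" for x y
      by (rule L[rule_format]) (use that in \<open>simp_all add: merge_def\<close>)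
    show "g u = g v"
      by (rule L[rule_format]) (use assms in \<open>simp_all add: merge_def\<close>)
  next
    fix x y
    assume R: "(\<forall>x\<in>V. \<forall>y\<in>V. c x = c y \<longrightarrow> g x = g y) \<and> g u = g v"
      and xy: "x \<in> V" "y \<in> V" "merge c u v x = merge c u v y"
    have resp: "g a = g b" if "a \<in> V" "b \<in> V" "c a = c b" for a b
      using R that by blast
    have "g u = g v" using R by blast
    consider "c x = c u" "c y = c u" | "c x = c u" "c y = c v" | "c x = c v" "c y = c u" | "c x = c y"
      using xy(3) unfolding merge_def by (cases "c x = c u"; cases "c y = c u") simp_all
    then show "g x = g y"
    proof cases
      case 1
      then show ?thesis using resp[OF xy(1) assms(1)] resp[OF xy(2) assms(1)] by blast
    next
      case 2
      then show ?thesis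
        using resp[OF xy(1) assms(1)] resp[OF xy(2) assms(2)] \<open>g u = g v\<close> by blast
    next
      case 3
      then show ?thesis
        using resp[OF xy(1) assms(2)] resp[OF xy(2) assms(1)] \<open>g u = g v\<close> by blast
    next
      case 4
      then show ?thesis using resp[OF xy(1,2)] by blast
    qed
  qed
  moreover have "(\<forall>e\<in>insert {u, v} F. \<forall>x\<in>e. \<forall>y\<in>e. g x = g y) \<longleftrightarrow>
      g u = g v \<and> (\<forall>e\<in>F. \<forall>x\<in>e. \<forall>y\<in>e. g x = g y)" for g :: "'a \<Rightarrow> bool"
    unfolding ball_simps ball_empty by blast
  ultimately show ?thesis
    unfolding joins_def by (simp only: imp_conjL)
qed

lemma card_merge:
  assumes "finite V" "u \<in> V" "v \<in> V" "c u \<noteq> c v"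
  shows "Suc (card (merge c u v ` V)) = card (c ` V)"
proof -
  have "merge c u v ` V = c ` V - {c u}"
  proof
    show "merge c u v ` V \<subseteq> c ` V - {c u}"
      using assms by (auto simp: merge_def)
    show "c ` V - {c u} \<subseteq> merge c u v ` V"
      by (force simp: merge_def image_iff)
  qed
  then show ?thesis
    using assms by (metis card_Suc_Diff1 finite_imageI imageI)
qed

lemma merge_same: "c u = c v \<Longrightarrow> merge c u v = c"
  by (auto simp: merge_def)

lemma joins_empty:
  assumes "finite V" "joins V c {}"
  shows "card (c ` V) \<le> 1"
proof (rule ccontr)
  assume "\<not> card (c ` V) \<le> 1"
  then obtain x y where xy: "x \<in> V" "y \<in> V" "c x \<noteq> c y"
    using card_le_Suc0_iff_eq[of "c ` V"] assms(1) by auto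
  have "(c x = c x) = (c y = c x)"
    by (rule joinsD[OF assms(2), of "\<lambda>z. c z = c x" x y, OF _ _ xy(1,2)]) simp_all
  with xy show False by simp
qed

text \<open>Contracting an edge lowers the number of labels by at most one, and in the end a single label is left.\<close>

lemma joins_card_le:
  assumes "finite V" "finite F" "F \<subseteq> vertex_pairs V" "joins V c F"
  shows "card (c ` V) \<le> Suc (card F)"
  using assms(2-4)
proof (induction F arbitrary: c rule: finite_induct)
  case empty
  then show ?case using joins_empty[OF assms(1)] by simp
next
  case (insert e F)
  then obtain u v where e: "e = {u, v}" and uv: "u \<in> V" "v \<in> V"
    by (auto simp: vertex_pairs_def)
  have "card (merge c u v ` V) \<le> Suc (card F)"
    using insert e joins_insert[OF uv] by blast
  moreover have "card (c ` V) \<le> Suc (card (merge c u v ` V))"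
    by (cases "c u = c v") (use card_merge[OF assms(1) uv, of c] in \<open>auto simp: merge_same\<close>)
  ultimately show ?case
    using insert by simp
qed

text \<open>In a minimal connecting edge set no edge joins two equal labels, so contracting an edge lowers the number of
labels by exactly one, and what remains is again minimal.\<close>

lemma minimal_joins_card:
  assumes "finite V" "V \<noteq> {}" "finite F" "F \<subseteq> vertex_pairs V" "joins V c F"
    and "\<And>e. e \<in> F \<Longrightarrow> \<not> joins V c (F - {e})"
  shows "Suc (card F) = card (c ` V)"
  using assms(3-6)
proof (induction F arbitrary: c rule: finite_induct)
  case empty
  have "card (c ` V) \<noteq> 0" using assms(1,2) by simp
  then show ?case using joins_empty[OF assms(1) empty.prems(2)] by simp
next
  case (insert e F)
  obtain u v where e: "e = {u, v}" and uv: "u \<in> V" "v \<in> V"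
    using insert.prems(1) by (auto simp: vertex_pairs_def)
  have "\<not> joins V c F"
    using insert.prems(3)[of e] insert.hyps by simp
  then have ne: "c u \<noteq> c v"
    using insert.prems(2) joins_insert[OF uv] e merge_same by metis
  have "\<not> joins V (merge c u v) (F - {d})" if "d \<in> F" for d
  proof -
    have "insert e (F - {d}) = insert e F - {d}"
      using that insert.hyps by auto
    then show ?thesis
      using insert.prems(3)[of d] that joins_insert[OF uv, of c "F - {d}"] e by simp
  qed
  then have "Suc (card F) = card (merge c u v ` V)"
    using insert.IH[of "merge c u v"] insert.prems joins_insert[OF uv, of c F] e by blast
  then show ?case
    using card_merge[OF assms(1) uv, of c] ne insert.hyps by simp
qed

definition quotient_trees :: "'a set \<Rightarrow> ('a \<Rightarrow> 'b) \<Rightarrow> 'a set set \<Rightarrow> 'a set set set" where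
  "quotient_trees V c E = {F. F \<subseteq> E \<and> joins V c F \<and> Suc (card F) = card (c ` V)}"

text \<open>The trees that contain the edge become, without it, the trees of the graph with \<open>u\<close> and \<open>v\<close> identified.
If \<open>u\<close> and \<open>v\<close> are identified already, the edge is a loop, and the edge count excludes it:
without the loop there would be too few edges to connect everything.\<close>

lemma deletion_contraction:
  assumes "finite V" "finite E" "E \<subseteq> vertex_pairs V" "{u, v} \<notin> E" "u \<in> V" "v \<in> V"
  shows "card (quotient_trees V c (insert {u, v} E)) =
    card (quotient_trees V c E) +
    (if c u = c v then 0 else card (quotient_trees V (merge c u v) E))"
proof -
  let ?e = "{u, v}"
  let ?with = "{F \<in> quotient_trees V c (insert ?e E). ?e \<in> F}"
  have fin: "finite F" if "F \<subseteq> insert ?e E" for F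
    using that assms(2) finite_subset by blast
  have split: "quotient_trees V c (insert ?e E) = quotient_trees V c E \<union> ?with"
    using assms(4) unfolding quotient_trees_def by blast
  have disj: "quotient_trees V c E \<inter> ?with = {}"
    using assms(4) unfolding quotient_trees_def by blast
  have fins: "finite (quotient_trees V c (insert ?e E))"
    by (rule finite_subset[of _ "Pow (insert ?e E)"])
      (use assms(2) in \<open>auto simp: quotient_trees_def\<close>)
  have "card ?with = (if c u = c v then 0 else card (quotient_trees V (merge c u v) E))"
  proof (cases "c u = c v")
    case True
    have "?with = {}"
    proof (rule ccontr)
      assume "?with \<noteq> {}"
      then obtain F where F: "F \<subseteq> insert ?e E" "joins V c F"
        "Suc (card F) = card (c ` V)" "?e \<in> F"
        unfolding quotient_trees_def by blast
      then have "joins V (merge c u v) (F - {?e})"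
        using joins_insert[OF assms(5,6), of c "F - {?e}"] by (simp add: insert_absorb)
      then have "joins V c (F - {?e})"
        using merge_same[of c u v] True by simp
      moreover have "F - {?e} \<subseteq> vertex_pairs V" "finite (F - {?e})"
        using F(1) assms(3) fin by auto
      ultimately have "card (c ` V) \<le> Suc (card (F - {?e}))"
        using joins_card_le[OF assms(1)] by blast
      also have "\<dots> = card F"
        using F(1,4) fin by (metis card_Suc_Diff1)
      finally show False using F(3) by simp
    qed
    then show ?thesis using True by (simp only: card.empty if_True refl)
  next
    case False
    have "bij_betw (insert ?e) (quotient_trees V (merge c u v) E) ?with"
    proof (rule bij_betwI[where g = "\<lambda>F. F - {?e}"])
      show "insert ?e \<in> quotient_trees V (merge c u v) E \<rightarrow> ?with"
      proof
        fix F assume "F \<in> quotient_trees V (merge c u v) E"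
        then have F: "F \<subseteq> E" "joins V (merge c u v) F" "Suc (card F) = card (merge c u v ` V)"
          unfolding quotient_trees_def by auto
        have "card (insert ?e F) = Suc (card F)"
          using F(1) assms(4) fin[of F] by (intro card_insert_disjoint) auto
        then show "insert ?e F \<in> ?with"
          using F joins_insert[OF assms(5,6), of c F] card_merge[OF assms(1,5,6), of c] False
          unfolding quotient_trees_def by auto
      qed
      show "(\<lambda>F. F - {?e}) \<in> ?with \<rightarrow> quotient_trees V (merge c u v) E"
      proof
        fix F assume "F \<in> ?with"
        then have F: "F \<subseteq> insert ?e E" "joins V c F" "Suc (card F) = card (c ` V)" "?e \<in> F"
          unfolding quotient_trees_def by auto
        have "Suc (card (F - {?e})) = card F"
          using F(1,4) fin by (metis card_Suc_Diff1)
        moreover have "joins V (merge c u v) (F - {?e})"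
          using F(2,4) joins_insert[OF assms(5,6), of c "F - {?e}"] by (simp add: insert_absorb)
        ultimately show "F - {?e} \<in> quotient_trees V (merge c u v) E"
          using F card_merge[OF assms(1,5,6), of c] False unfolding quotient_trees_def by auto
      qed
    next
      fix F assume "F \<in> quotient_trees V (merge c u v) E"
      then show "insert ?e F - {?e} = F"
        using assms(4) unfolding quotient_trees_def by auto
    next
      fix F assume "F \<in> ?with"
      then show "insert ?e (F - {?e}) = F" by auto
    qed
    then show ?thesis using False bij_betw_same_card by fastforce
  qed
  moreover have "card (quotient_trees V c (insert ?e E)) = card (quotient_trees V c E) + card ?with"
    using card_Un_disjoint[OF _ _ disj] fins split by (metis (no_types, lifting) finite_Un)
  ultimately show ?thesis by simp
qed

text \<open>Only the partition of the vertices into fibres matters, so labellings may be normalised and may even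
have different label types.\<close>

lemma quotient_trees_cong:
  assumes "\<And>x y. x \<in> V \<Longrightarrow> y \<in> V \<Longrightarrow> c x = c y \<longleftrightarrow> d x = d y"
  shows "quotient_trees V c E = quotient_trees V d E"
proof -
  have "(\<forall>x\<in>V. \<forall>y\<in>V. c x = c y \<longrightarrow> g x = g y) \<longleftrightarrow>
      (\<forall>x\<in>V. \<forall>y\<in>V. d x = d y \<longrightarrow> g x = g y)" for g :: "'a \<Rightarrow> bool"
    by (intro ball_cong refl) (simp add: assms)
  then have "joins V c F = joins V d F" for F
    unfolding joins_def by (simp only:)
  moreover have "card (c ` V) = card (d ` V)"
  proof -
    define h where "h = d \<circ> inv_into V c"
    have h: "h (c x) = d x" if "x \<in> V" for x
    proof -
      have "inv_into V c (c x) \<in> V" "c (inv_into V c (c x)) = c x"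
        using that by (auto intro: inv_into_into f_inv_into_f)
      then show ?thesis
        using assms[of "inv_into V c (c x)" x] that unfolding h_def comp_def by blast
    qed
    have "d ` V = h ` (c ` V)"
      using h unfolding image_image by (intro image_cong) simp_all
    moreover have "inj_on h (c ` V)"
    proof (rule inj_onI)
      fix a b assume "a \<in> c ` V" "b \<in> c ` V" "h a = h b"
      then obtain x y where xy: "x \<in> V" "y \<in> V" "a = c x" "b = c y" by blast
      then have "d x = d y" using h \<open>h a = h b\<close> by simp
      then show "a = b" using assms xy by blast
    qed
    ultimately show ?thesis by (simp add: card_image)
  qed
  ultimately show ?thesis
    unfolding quotient_trees_def by simp
qed

lemma vertex_pairs_mono: "V \<subseteq> W \<Longrightarrow> vertex_pairs V \<subseteq> vertex_pairs W"
  unfolding vertex_pairs_def by blast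

text \<open>A vertex without edges of its own that is identified with a vertex \<open>w\<close> is redundant: a cut of \<open>V\<close> extends
to \<open>v\<close> in only one way, namely by its value at \<open>w\<close>.\<close>

lemma quotient_trees_drop_vertex:
  assumes "E \<subseteq> vertex_pairs V" "w \<in> V" "c w = c v"
  shows "quotient_trees (insert v V) c E = quotient_trees V c E"
proof -
  have "joins (insert v V) c F \<longleftrightarrow> joins V c F" if F: "F \<subseteq> E" for F
  proof
    assume j: "joins (insert v V) c F"
    show "joins V c F"
    proof (rule joinsI)
      fix g x y
      assume c: "\<And>x y. \<lbrakk>x \<in> V; y \<in> V; c x = c y\<rbrakk> \<Longrightarrow> (g x :: bool) = g y"
        and e: "\<And>e x y. \<lbrakk>e \<in> F; x \<in> e; y \<in> e\<rbrakk> \<Longrightarrow> g x = g y" and xy: "x \<in> V" "y \<in> V"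
      let ?r = "\<lambda>z. if z \<in> V then z else w"
      have "g (?r x) = g (?r y)"
      proof (rule joinsD[OF j, where g = "\<lambda>z. g (?r z)"])
        fix a b assume ab: "a \<in> insert v V" "b \<in> insert v V" "c a = c b"
        have r: "c (?r z) = c z" "?r z \<in> V" if "z \<in> insert v V" for z
          using that assms(2,3) by auto
        show "g (?r a) = g (?r b)"
          by (rule c) (use r[OF ab(1)] r[OF ab(2)] ab(3) in auto)
      next
        fix d a b assume d: "d \<in> F" "a \<in> d" "b \<in> d"
        then have "a \<in> V" "b \<in> V"
          using F assms(1) unfolding vertex_pairs_def by auto
        then show "g (?r a) = g (?r b)"
          using e[OF d] by simp
      qed (use xy in auto)
      then show "g x = g y" using xy by simp
    qed
  next
    assume j: "joins V c F"
    show "joins (insert v V) c F"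
    proof (rule joinsI)
      fix g x y
      assume c: "\<And>x y. \<lbrakk>x \<in> insert v V; y \<in> insert v V; c x = c y\<rbrakk> \<Longrightarrow> (g x :: bool) = g y"
        and e: "\<And>e x y. \<lbrakk>e \<in> F; x \<in> e; y \<in> e\<rbrakk> \<Longrightarrow> g x = g y"
        and xy: "x \<in> insert v V" "y \<in> insert v V"
      have "g z = g w" if "z \<in> insert v V" for z
      proof (cases "z \<in> V")
        case True
        show ?thesis
          by (rule joinsD[OF j, of g z w, OF _ e True assms(2)]) (rule c; simp)
      next
        case False
        then have "z = v" using that by simp
        then show ?thesis using c[of v w] assms(2,3) by simp
      qed
      then show "g x = g y" using xy by simp
    qed
  qed
  moreover have "c ` insert v V = c ` V"
    using assms(2,3) by (metis image_insert insert_absorb imageI)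
  ultimately show ?thesis
    unfolding quotient_trees_def by auto
qed

text \<open>The cut that separates \<open>v\<close> from everything else is not crossed.\<close>

lemma quotient_trees_isolated:
  assumes "E \<subseteq> vertex_pairs V" "w \<in> V" "v \<notin> V" "\<And>x. x \<in> V \<Longrightarrow> c x \<noteq> c v"
  shows "quotient_trees (insert v V) c E = {}"
proof -
  have False if F: "F \<subseteq> E" and j: "joins (insert v V) c F" for F
  proof -
    have "(w = v) = (v = v)"
    proof (rule joinsD[OF j, where g = "\<lambda>z. z = v"])
      fix x y assume "x \<in> insert v V" "y \<in> insert v V" "c x = c y"
      then show "(x = v) = (y = v)" using assms(4) by fastforce
    next
      fix e x y assume "e \<in> F" "x \<in> e" "y \<in> e"
      then have "x \<in> V" "y \<in> V"
        using F assms(1) unfolding vertex_pairs_def by auto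
      then show "(x = v) = (y = v)" using assms(3) by auto
    qed (use assms(2) in auto)
    then show False using assms(2,3) by auto
  qed
  then show ?thesis unfolding quotient_trees_def by blast
qed

section \<open>Trees as connected graphs with one edge less than vertices\<close>

lemma walk_snoc:
  assumes "walk_betw G u p x" "{x, y} \<in> edges G" "y \<in> vertices G"
  shows "walk_betw G u (p @ [y]) y"
proof -
  have p: "p \<noteq> []" "hd p = u" "last p = x" "set p \<subseteq> vertices G"
    "\<And>i. Suc i < length p \<Longrightarrow> {p ! i, p ! Suc i} \<in> edges G"
    using assms(1) unfolding walk_betw_def by auto
  have "{(p @ [y]) ! i, (p @ [y]) ! Suc i} \<in> edges G" if "Suc i < length (p @ [y])" for i
  proof (cases "Suc i < length p")
    case True
    then show ?thesis using p(5)[of i] by (simp add: nth_append)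
  next
    case False
    then have "Suc i = length p" using that by simp
    then have "(p @ [y]) ! i = x" "(p @ [y]) ! Suc i = y"
      using p(1,3) by (auto simp: nth_append last_conv_nth simp flip: \<open>Suc i = length p\<close>)
    then show ?thesis using assms(2) by simp
  qed
  then show ?thesis
    using p assms(3) unfolding walk_betw_def by auto
qed

lemma walk_prefix:
  assumes "walk_betw G u (p @ y # q) x"
  shows "walk_betw G u (p @ [y]) y"
proof -
  have e: "{(p @ y # q) ! i, (p @ y # q) ! Suc i} \<in> edges G" if "Suc i < length (p @ y # q)" for i
    using assms that unfolding walk_betw_def by blast
  have nth: "(p @ [y]) ! i = (p @ y # q) ! i" if "i < length (p @ [y])" for i
    using that by (auto simp: nth_append)
  have "{(p @ [y]) ! i, (p @ [y]) ! Suc i} \<in> edges G" if "Suc i < length (p @ [y])" for i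
    using e[of i] nth[of i] nth[of "Suc i"] that by simp
  moreover have "hd (p @ [y]) = u"
    using assms unfolding walk_betw_def by (cases p) auto
  ultimately show ?thesis
    using assms unfolding walk_betw_def by auto
qed

lemma walk_constant:
  assumes "walk_betw G u p v" "\<And>i. Suc i < length p \<Longrightarrow> g (p ! i) = g (p ! Suc i)"
  shows "g u = g v"
proof -
  have "g (p ! 0) = g (p ! i)" if "i < length p" for i
    using that by (induction i) (use assms(2) in auto)
  from this[of "length p - 1"] show ?thesis
    using assms(1) unfolding walk_betw_def by (auto simp: hd_conv_nth last_conv_nth)
qed

text \<open>The vertices that a repetition-free walk from \<open>u\<close> can reach form one side of a cut that no edge crosses: such a
walk is extended by an edge, or cut short if it has visited the new vertex before. Building walks without
repetition from the start lets a walk that avoids an edge close up to a cycle below.\<close>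

lemma joins_distinct_walk:
  assumes "joins (vertices G) id (edges G)" "edges G \<subseteq> vertex_pairs (vertices G)"
    and "u \<in> vertices G" "v \<in> vertices G"
  obtains p where "walk_betw G u p v" "distinct p"
proof -
  define g where "g x \<longleftrightarrow> (\<exists>p. walk_betw G u p x \<and> distinct p)" for x
  have step: "g y" if "g x" "{x, y} \<in> edges G" for x y
  proof -
    obtain p where p: "walk_betw G u p x" "distinct p"
      using \<open>g x\<close> unfolding g_def by blast
    have y: "y \<in> vertices G"
      using subsetD[OF assms(2) that(2)] by (auto simp: vertex_pairs_def doubleton_eq_iff)
    show ?thesis
    proof (cases "y \<in> set p")
      case True
      then obtain p1 p2 where "p = p1 @ y # p2"
        by (meson split_list)
      then show ?thesis
        using walk_prefix[of G u p1 y p2 x] p unfolding g_def by force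
    next
      case False
      then show ?thesis
        using walk_snoc[OF p(1) that(2) y] p(2) unfolding g_def by force
    qed
  qed
  have edge: "g x = g y" if "e \<in> edges G" "x \<in> e" "y \<in> e" for e x y
  proof (cases "x = y")
    case False
    then have "e = {x, y}"
      using subsetD[OF assms(2) that(1)] that(2,3) by (auto simp: vertex_pairs_def)
    then have "{x, y} \<in> edges G" "{y, x} \<in> edges G"
      using that(1) by (auto simp: insert_commute)
    then show ?thesis
      using step by blast
  qed simp
  have "g u = g v"
    by (rule joinsD[OF assms(1), of g u v, OF _ edge assms(3,4)]) simp_all
  moreover have "g u"
    unfolding g_def walk_betw_def using assms(3) by (intro exI[of _ "[u]"]) simp
  ultimately show ?thesis
    using that unfolding g_def by blast
qed

lemma connected_graph_iff_joins:
  assumes "simple_graph G"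
  shows "connected_graph G \<longleftrightarrow> vertices G \<noteq> {} \<and> joins (vertices G) id (edges G)"
proof -
  have sub: "edges G \<subseteq> vertex_pairs (vertices G)"
    using assms unfolding simple_graph_def vertex_pairs_def by simp
  have "joins (vertices G) id (edges G)"
    if walks: "\<forall>u\<in>vertices G. \<forall>v\<in>vertices G. \<exists>p. walk_betw G u p v"
  proof (rule joinsI)
    fix g x y
    assume g: "\<And>e x y. \<lbrakk>e \<in> edges G; x \<in> e; y \<in> e\<rbrakk> \<Longrightarrow> (g x :: bool) = g y"
      and "x \<in> vertices G" "y \<in> vertices G"
    then obtain p where "walk_betw G x p y" using walks by blast
    then show "g x = g y"
      by (rule walk_constant) (use \<open>walk_betw G x p y\<close> g in \<open>simp add: walk_betw_def, blast\<close>)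
  qed
  then show ?thesis
    unfolding connected_graph_def using joins_distinct_walk[OF _ sub] by metis
qed

text \<open>An acyclic connected graph is minimally connected, because a repetition-free walk between the
ends of a superfluous edge would close up to a cycle. Conversely, removing an edge of a cycle
keeps the graph connected, which is impossible if there are only just enough edges.\<close>

lemma tree_graph_iff_card:
  assumes "simple_graph G"
  shows "tree_graph G \<longleftrightarrow> vertices G \<noteq> {} \<and> joins (vertices G) id (edges G) \<and>
    Suc (card (edges G)) = card (vertices G)"
proof -
  let ?V = "vertices G" and ?E = "edges G"
  have finV: "finite ?V" and sub: "?E \<subseteq> vertex_pairs ?V"
    using assms unfolding simple_graph_def vertex_pairs_def by auto
  have finE: "finite ?E"
    by (rule finite_subset[of _ "Pow ?V"]) (use sub finV in \<open>auto simp: vertex_pairs_def\<close>)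
  have "Suc (card ?E) = card ?V"
    if ne: "?V \<noteq> {}" and joins: "joins ?V id ?E" and acyclic: "\<nexists>c. graph_cycle G c"
  proof -
    have "\<not> joins ?V id (?E - {e})" if e: "e \<in> ?E" for e
    proof
      assume j: "joins ?V id (?E - {e})"
      obtain u v where uv: "e = {u, v}" "u \<in> ?V" "v \<in> ?V" "u \<noteq> v"
        using subsetD[OF sub e] by (auto simp: vertex_pairs_def)
      let ?G = "\<lparr>vertices = ?V, edges = ?E - {e}\<rparr>"
      obtain p where p: "walk_betw ?G u p v" "distinct p"
        by (rule joins_distinct_walk[of ?G u v]) (use j sub uv in auto)
      have "length p \<noteq> 1"
      proof
        assume "length p = 1"
        then show False using p(1) uv(4) unfolding walk_betw_def
          by (auto simp: length_Suc_conv)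
      qed
      moreover have "length p \<noteq> 2"
      proof
        assume "length p = 2"
        then obtain a b where "p = [a, b]"
          by (metis One_nat_def Suc_1 length_0_conv length_Suc_conv)
        then show False using p(1) uv(1) unfolding walk_betw_def by auto
      qed
      moreover have "length p \<noteq> 0"
        using p(1) unfolding walk_betw_def by auto
      ultimately have "3 \<le> length p" by linarith
      moreover have "walk_betw G u p v" "hd p = u" "last p = v"
        using p(1) unfolding walk_betw_def by auto
      moreover have "{v, u} \<in> ?E"
        using e uv(1) by (simp add: insert_commute)
      ultimately have "graph_cycle G p"
        unfolding graph_cycle_def using p(2) by simp
      then show False using acyclic by blast
    qed
    then show ?thesis
      using minimal_joins_card[OF finV ne finE sub joins] by simp
  qed
  moreover have False
    if joins: "joins ?V id ?E" and card: "Suc (card ?E) = card ?V" and cyc: "graph_cycle G c" for c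
  proof -
    let ?e = "{last c, hd c}"
    have c: "3 \<le> length c" "distinct c" "walk_betw G (hd c) c (last c)" "?e \<in> ?E"
      using cyc unfolding graph_cycle_def by auto
    have cne: "c \<noteq> []" using c(1) by auto
    have avoid: "{c ! i, c ! Suc i} \<in> ?E - {?e}" if i: "Suc i < length c" for i
    proof -
      have "{c ! i, c ! Suc i} \<noteq> {c ! (length c - 1), c ! 0}"
      proof
        assume "{c ! i, c ! Suc i} = {c ! (length c - 1), c ! 0}"
        then have "i = length c - 1 \<and> Suc i = 0 \<or> i = 0 \<and> Suc i = length c - 1"
          using i nth_eq_iff_index_eq[OF c(2), of i "length c - 1"]
            nth_eq_iff_index_eq[OF c(2), of "Suc i" 0] nth_eq_iff_index_eq[OF c(2), of i 0]
            nth_eq_iff_index_eq[OF c(2), of "Suc i" "length c - 1"]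
          unfolding doubleton_eq_iff by linarith
        then show False using c(1) i by auto
      qed
      then show ?thesis
        using c(3) i cne unfolding walk_betw_def by (simp add: hd_conv_nth last_conv_nth)
    qed
    have "joins ?V id (?E - {?e})"
    proof (rule joinsI)
      fix g x y
      assume g: "\<And>e x y. \<lbrakk>e \<in> ?E - {?e}; x \<in> e; y \<in> e\<rbrakk> \<Longrightarrow> (g x :: bool) = g y"
        and xy: "x \<in> ?V" "y \<in> ?V"
      have ends: "g (hd c) = g (last c)"
        by (rule walk_constant[OF c(3)]) (use avoid g in blast)
      have edge: "g a = g b" if "e \<in> ?E" "a \<in> e" "b \<in> e" for e a b
        using that g[of e a b] ends by (cases "e = ?e") auto
      show "g x = g y"
        by (rule joinsD[OF joins, of g x y, OF _ edge xy]) simp_all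
    qed
    then have "card (id ` ?V) \<le> Suc (card (?E - {?e}))"
      using joins_card_le[OF finV, of "?E - {?e}" id] finE sub by blast
    also have "\<dots> = card ?E"
      using c(4) finE by (metis card_Suc_Diff1)
    finally show False using card by simp
  qed
  ultimately show ?thesis
    unfolding tree_graph_def using connected_graph_iff_joins[OF assms] assms by blast
qed

lemma num_spanning_trees_eq_card_quotient_trees:
  assumes "simple_graph G" "vertices G \<noteq> {}"
  shows "num_spanning_trees G = card (quotient_trees (vertices G) id (edges G))"
proof -
  have simple: "simple_graph \<lparr>vertices = vertices G, edges = F\<rparr>" if "F \<subseteq> edges G" for F
    using assms(1) that unfolding simple_graph_def by auto
  have "spanning_trees G =
      (\<lambda>F. \<lparr>vertices = vertices G, edges = F\<rparr>) ` quotient_trees (vertices G) id (edges G)"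
    (is "_ = ?h ` _")
  proof (intro equalityI subsetI)
    fix T assume T: "T \<in> spanning_trees G"
    then have "T = ?h (edges T)" "edges T \<subseteq> edges G" "tree_graph T" "vertices T = vertices G"
      unfolding spanning_trees_def by auto
    moreover from this have "edges T \<in> quotient_trees (vertices G) id (edges G)"
      using tree_graph_iff_card[of T] unfolding quotient_trees_def tree_graph_def by auto
    ultimately show "T \<in> ?h ` quotient_trees (vertices G) id (edges G)"
      by blast
  next
    fix T assume "T \<in> ?h ` quotient_trees (vertices G) id (edges G)"
    then obtain F where "T = ?h F" "F \<subseteq> edges G" "joins (vertices G) id F"
      "Suc (card F) = card (vertices G)"
      unfolding quotient_trees_def by auto
    then show "T \<in> spanning_trees G"
      using tree_graph_iff_card[OF simple, of F] assms(2) unfolding spanning_trees_def by simp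
  qed
  moreover have "inj_on ?h (quotient_trees (vertices G) id (edges G))"
    by (auto intro: inj_onI)
  ultimately show ?thesis
    unfolding num_spanning_trees_def by (simp add: card_image)
qed

section \<open>Powers of paths\<close>

lemma walk_rev:
  assumes "walk_betw G u p v"
  shows "walk_betw G v (rev p) u"
proof -
  have "{rev p ! i, rev p ! Suc i} \<in> edges G" if i: "Suc i < length p" for i
  proof -
    have "rev p ! i = p ! Suc (length p - Suc (Suc i))"
      using i by (simp add: rev_nth Suc_diff_Suc)
    moreover have "rev p ! Suc i = p ! (length p - Suc (Suc i))"
      using i by (simp add: rev_nth)
    moreover have "Suc (length p - Suc (Suc i)) < length p"
      using i by linarith
    ultimately show ?thesis
      using assms unfolding walk_betw_def by (simp add: insert_commute)
  qed
  then show ?thesis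
    using assms unfolding walk_betw_def by (simp add: hd_rev last_rev)
qed

text \<open>Each step of a walk changes the position by exactly one, so the distance is at least the difference of the positions.\<close>

lemma path_graph_walk_length:
  assumes "walk_betw (path_graph n) u p v"
  shows "v \<le> u + (length p - 1)" "u \<le> v + (length p - 1)"
proof -
  have "p ! i \<le> u + i \<and> u \<le> p ! i + i" if "i < length p" for i
    using that
  proof (induction i)
    case 0
    then show ?case using assms unfolding walk_betw_def by (auto simp: hd_conv_nth)
  next
    case (Suc i)
    then have "{p ! i, p ! Suc i} \<in> edges (path_graph n)"
      using assms unfolding walk_betw_def by blast
    then have "p ! Suc i = Suc (p ! i) \<or> p ! i = Suc (p ! Suc i)"
      unfolding path_graph_def by (auto simp: doubleton_eq_iff)
    then show ?case using Suc by auto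
  qed
  from this[of "length p - 1"] show "v \<le> u + (length p - 1)" "u \<le> v + (length p - 1)"
    using assms unfolding walk_betw_def by (auto simp: last_conv_nth)
qed

lemma path_graph_upward_walk:
  assumes "u \<le> v" "v < n"
  shows "walk_betw (path_graph n) u [u..<Suc v] v"
  using assms unfolding walk_betw_def path_graph_def
  by (auto simp: hd_conv_nth last_conv_nth nth_append simp del: upt_Suc)

lemma graph_distance_path_graph:
  assumes "u \<le> v" "v < n"
  shows "graph_distance (path_graph n) u v = enat (v - u)"
    and "graph_distance (path_graph n) v u = enat (v - u)"
proof -
  note up = path_graph_upward_walk[OF assms]
  show "graph_distance (path_graph n) u v = enat (v - u)"
    unfolding graph_distance_def
  proof (rule antisym)
    show "(INF p\<in>{p. walk_betw (path_graph n) u p v}. enat (length p - 1)) \<le> enat (v - u)"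
      by (rule INF_lower2[of "[u..<Suc v]"]) (use up in auto)
    show "enat (v - u) \<le> (INF p\<in>{p. walk_betw (path_graph n) u p v}. enat (length p - 1))"
      by (rule INF_greatest) (use path_graph_walk_length[of n u _ v] in \<open>fastforce\<close>)
  qed
  show "graph_distance (path_graph n) v u = enat (v - u)"
    unfolding graph_distance_def
  proof (rule antisym)
    show "(INF p\<in>{p. walk_betw (path_graph n) v p u}. enat (length p - 1)) \<le> enat (v - u)"
      by (rule INF_lower2[of "rev [u..<Suc v]"]) (use walk_rev[OF up] in auto)
    show "enat (v - u) \<le> (INF p\<in>{p. walk_betw (path_graph n) v p u}. enat (length p - 1))"
      by (rule INF_greatest) (use path_graph_walk_length[of n v _ u] in \<open>fastforce\<close>)
  qed
qed

definition path_power_edges :: "nat \<Rightarrow> nat \<Rightarrow> nat set set" where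
  "path_power_edges k n = {{i, j} | i j. i < j \<and> j < n \<and> j \<le> i + k}"

lemma graph_power_path_graph:
  "graph_power (path_graph n) k = \<lparr>vertices = {0..<n}, edges = path_power_edges k n\<rparr>"
proof -
  have dist: "1 \<le> graph_distance (path_graph n) i j \<and> graph_distance (path_graph n) i j \<le> enat k \<longleftrightarrow>
      i < j \<and> j \<le> i + k" if "i \<le> j" "j < n" for i j
    using graph_distance_path_graph[OF that] that by (auto simp: one_enat_def)
  have dist': "1 \<le> graph_distance (path_graph n) j i \<and> graph_distance (path_graph n) j i \<le> enat k \<longleftrightarrow>
      i < j \<and> j \<le> i + k" if "i \<le> j" "j < n" for i j
    using graph_distance_path_graph[OF that] that by (auto simp: one_enat_def)
  have verts: "vertices (path_graph n) = {0..<n}"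
    by (simp add: path_graph_def)
  have "{{u, v} |u v. u \<in> vertices (path_graph n) \<and> v \<in> vertices (path_graph n) \<and>
      1 \<le> graph_distance (path_graph n) u v \<and> graph_distance (path_graph n) u v \<le> enat k} =
    path_power_edges k n" (is "?L = _")
  proof (intro equalityI subsetI)
    fix e assume "e \<in> ?L"
    then obtain u v where e: "e = {u, v}" "u < n" "v < n"
      "1 \<le> graph_distance (path_graph n) u v \<and> graph_distance (path_graph n) u v \<le> enat k"
      unfolding verts by auto
    consider "u \<le> v" | "v \<le> u" by linarith
    then show "e \<in> path_power_edges k n"
    proof cases
      case 1
      then show ?thesis using dist[OF 1 e(3)] e unfolding path_power_edges_def by blast
    next
      case 2
      then have "v < u \<and> u \<le> v + k" using dist'[OF 2 e(2)] e by blast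
      moreover have "e = {v, u}" using e(1) by auto
      ultimately show ?thesis using e unfolding path_power_edges_def by blast
    qed
  next
    fix e assume "e \<in> path_power_edges k n"
    then obtain i j where "e = {i, j}" "i < j" "j < n" "j \<le> i + k"
      unfolding path_power_edges_def by blast
    moreover from this have "1 \<le> graph_distance (path_graph n) i j \<and>
        graph_distance (path_graph n) i j \<le> enat k"
      using dist[of i j] by simp
    moreover from calculation have "i \<in> {0..<n}" "j \<in> {0..<n}" by auto
    ultimately show "e \<in> ?L" unfolding verts by blast
  qed
  then show ?thesis
    unfolding graph_power_def verts by simp
qed

lemma path_power_edges_pairs: "path_power_edges k n \<subseteq> vertex_pairs {0..<n}"
proof
  fix e assume "e \<in> path_power_edges k n"
  then obtain i j where "e = {i, j}" "i < j" "j < n"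
    unfolding path_power_edges_def by blast
  then show "e \<in> vertex_pairs {0..<n}"
    unfolding vertex_pairs_def by (intro CollectI exI[of _ i] exI[of _ j]) simp
qed

lemma finite_path_power_edges: "finite (path_power_edges k n)"
proof (rule finite_subset)
  show "path_power_edges k n \<subseteq> Pow {0..<n}"
    unfolding path_power_edges_def by auto
qed simp

text \<open>The edges from vertex \<open>n\<close> to its \<open>j\<close> immediate predecessors. They are added one at a time, so that
each of them can be deleted or contracted in turn.\<close>

definition back_edges :: "nat \<Rightarrow> nat \<Rightarrow> nat set set" where
  "back_edges n j = (\<lambda>i. {n - i, n}) ` {1..j}"

lemma path_power_edges_Suc:
  "path_power_edges k (Suc n) = path_power_edges k n \<union> back_edges n (min k n)"
proof (intro equalityI subsetI)
  fix e assume "e \<in> path_power_edges k (Suc n)"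
  then obtain i j where e: "e = {i, j}" "i < j" "j < Suc n" "j \<le> i + k"
    unfolding path_power_edges_def by blast
  show "e \<in> path_power_edges k n \<union> back_edges n (min k n)"
  proof (cases "j < n")
    case True
    then show ?thesis using e unfolding path_power_edges_def by blast
  next
    case False
    then have "e = {n - (n - i), n}" "n - i \<in> {1..min k n}" using e by auto
    then show ?thesis unfolding back_edges_def by blast
  qed
next
  fix e assume "e \<in> path_power_edges k n \<union> back_edges n (min k n)"
  then show "e \<in> path_power_edges k (Suc n)"
  proof
    assume "e \<in> path_power_edges k n"
    then obtain i j where "e = {i, j}" "i < j" "j < n" "j \<le> i + k"
      unfolding path_power_edges_def by blast
    then show ?thesis
      unfolding path_power_edges_def by (intro CollectI exI[of _ i] exI[of _ j]) auto
  next
    assume "e \<in> back_edges n (min k n)"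
    then obtain i where "e = {n - i, n}" "1 \<le> i" "i \<le> k" "i \<le> n"
      unfolding back_edges_def by auto
    then show ?thesis
      unfolding path_power_edges_def by (intro CollectI exI[of _ "n - i"] exI[of _ n]) auto
  qed
qed

lemma back_edges_Suc:
  "back_edges n (Suc j) = insert {n - Suc j, n} (back_edges n j)"
  unfolding back_edges_def by (simp add: atLeastAtMostSuc_conv)

lemma back_edge_fresh:
  assumes "Suc j \<le> n"
  shows "{n - Suc j, n} \<notin> path_power_edges k n \<union> back_edges n j"
  using assms unfolding path_power_edges_def back_edges_def
  by (auto simp: doubleton_eq_iff)

lemma back_edges_pairs:
  assumes "j \<le> n"
  shows "back_edges n j \<subseteq> vertex_pairs {0..<Suc n}"
proof
  fix e assume "e \<in> back_edges n j"
  then obtain i where "e = {n - i, n}" "1 \<le> i" "i \<le> j" unfolding back_edges_def by auto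
  then show "e \<in> vertex_pairs {0..<Suc n}"
    using assms unfolding vertex_pairs_def
    by (intro CollectI exI[of _ "n - i"] exI[of _ n]) auto
qed

section \<open>Sweeping over the last vertex\<close>

text \<open>The labels of the last \<open>length xs\<close> vertices are listed in \<open>xs\<close>, starting from the last vertex \<open>n - 1\<close>; all
other vertices have labels of their own, tagged by \<open>Inl\<close> so that they never clash with the listed ones.\<close>

definition frontier_label :: "nat \<Rightarrow> nat list \<Rightarrow> nat \<Rightarrow> nat + nat" where
  "frontier_label n xs x = (if x + length xs < n then Inl x else Inr (xs ! (n - 1 - x)))"

definition frontier_trees :: "nat \<Rightarrow> nat \<Rightarrow> nat list \<Rightarrow> nat" where
  "frontier_trees k n xs =
     card (quotient_trees {0..<n} (frontier_label n xs) (path_power_edges k n))"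

lemma frontier_label_cong:
  assumes "length xs = length ys" "x < n" "y < n"
    and "\<And>i j. i < length xs \<Longrightarrow> j < length xs \<Longrightarrow> xs ! i = xs ! j \<longleftrightarrow> ys ! i = ys ! j"
  shows "frontier_label n xs x = frontier_label n xs y \<longleftrightarrow>
    frontier_label n ys x = frontier_label n ys y"
proof (cases "x + length xs < n \<or> y + length xs < n")
  case True
  then show ?thesis using assms(1) unfolding frontier_label_def by auto
next
  case False
  then have "n - 1 - x < length xs" "n - 1 - y < length xs" using assms(2,3) by linarith+
  from assms(4)[OF this] False show ?thesis
    using assms(1) unfolding frontier_label_def by simp
qed

lemma num_spanning_trees_path_power:
  assumes "0 < n" "m \<le> n"
  shows "num_spanning_trees (graph_power (path_graph n) k) = frontier_trees k n [0..<m]"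
proof -
  let ?G = "\<lparr>vertices = {0..<n}, edges = path_power_edges k n\<rparr>"
  have "simple_graph ?G"
    using path_power_edges_pairs[of k n] unfolding simple_graph_def vertex_pairs_def by simp
  then have "num_spanning_trees ?G = card (quotient_trees {0..<n} id (path_power_edges k n))"
    using num_spanning_trees_eq_card_quotient_trees[of ?G] assms(1) by simp
  also have "quotient_trees {0..<n} id (path_power_edges k n) =
      quotient_trees {0..<n} (frontier_label n [0..<m]) (path_power_edges k n)"
    by (rule quotient_trees_cong) (use assms in \<open>auto simp: frontier_label_def\<close>)
  finally show ?thesis
    unfolding graph_power_path_graph frontier_trees_def .
qed

text \<open>The normal form of a labelling: each entry is replaced by the position of the first equal entry. Lists that describe the
same partition have the same normal form, and all entries are smaller than the length of the list, which is
therefore a fresh label.\<close>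

definition first_positions :: "'a list \<Rightarrow> nat list" where
  "first_positions xs = map (\<lambda>x. length (takeWhile (\<lambda>y. y \<noteq> x) xs)) xs"

lemma length_first_positions [simp]: "length (first_positions xs) = length xs"
  by (simp add: first_positions_def)

lemma first_positions_nth_eq:
  assumes "i < length xs" "j < length xs"
  shows "first_positions xs ! i = first_positions xs ! j \<longleftrightarrow> xs ! i = xs ! j"
proof -
  have "xs ! length (takeWhile (\<lambda>y. y \<noteq> x) xs) = x" if "x \<in> set xs" for x
    using that by (induction xs) auto
  then have "xs ! (first_positions xs ! i) = xs ! i" if "i < length xs" for i
    using that by (simp add: first_positions_def)
  then show ?thesis
    using assms by (metis first_positions_def nth_map)
qed

text \<open>The head of \<open>xs\<close> is the label of the vertex to be removed, and the entries at positions 1 to \<open>j\<close> are those of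
its remaining neighbours. Every choice of deletions and contractions contributes one
labelling of the other vertices, or none if the vertex ends up isolated; repetitions in the
result are multiplicities.\<close>

fun absorb :: "nat \<Rightarrow> nat list \<Rightarrow> nat list list" where
  "absorb 0 xs = (if hd xs \<in> set (tl xs) then [first_positions (tl xs)] else [])"
| "absorb (Suc j) xs = absorb j xs @
     (if hd xs = xs ! Suc j then []
      else absorb j (map (\<lambda>l. if l = xs ! Suc j then hd xs else l) xs))"

lemma length_absorb: "ys \<in> set (absorb j xs) \<Longrightarrow> length ys = length xs - 1"
  by (induction j xs rule: absorb.induct) (auto split: if_splits)

text \<open>Once all its edges are processed, the last vertex either shares its label with another vertex and can be dropped, or
it is isolated.\<close>

lemma card_quotient_trees_drop:
  assumes "length xs = Suc m" "0 < m" "m \<le> n"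
  shows "card (quotient_trees {0..<Suc n} (frontier_label (Suc n) xs) (path_power_edges k n)) =
    (\<Sum>ys\<leftarrow>absorb 0 xs. frontier_trees k n ys)"
proof -
  obtain a as where xs: "xs = a # as" "length as = m"
    using assms(1) by (metis length_Suc_conv)
  have V: "{0..<Suc n} = insert n {0..<n}"
    by auto
  have lab: "frontier_label (Suc n) xs x = frontier_label n as x" if "x < n" for x
  proof -
    have "n - x = Suc (n - 1 - x)" using that by linarith
    then show ?thesis
      unfolding frontier_label_def using xs by simp
  qed
  have labn: "frontier_label (Suc n) xs n = Inr a"
    unfolding frontier_label_def using xs by simp
  show ?thesis
  proof (cases "a \<in> set as")
    case True
    then obtain i where i: "i < m" "as ! i = a"
      using xs(2) by (metis in_set_conv_nth)
    have w: "frontier_label (Suc n) xs (n - 1 - i) = frontier_label (Suc n) xs n"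
      unfolding labn using lab[of "n - 1 - i"] i assms xs(2)
      unfolding frontier_label_def by simp
    have "quotient_trees {0..<Suc n} (frontier_label (Suc n) xs) (path_power_edges k n) =
        quotient_trees {0..<n} (frontier_label (Suc n) xs) (path_power_edges k n)"
      unfolding V
      by (rule quotient_trees_drop_vertex[where w = "n - 1 - i"])
        (use path_power_edges_pairs w i assms in auto)
    also have "\<dots> = quotient_trees {0..<n} (frontier_label n (first_positions as)) (path_power_edges k n)"
    proof (rule quotient_trees_cong)
      fix x y assume "x \<in> {0..<n}" "y \<in> {0..<n}"
      then show "frontier_label (Suc n) xs x = frontier_label (Suc n) xs y \<longleftrightarrow>
          frontier_label n (first_positions as) x = frontier_label n (first_positions as) y"
        using lab frontier_label_cong[of as "first_positions as" x n y] first_positions_nth_eq[of _ as]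
        by simp
    qed
    finally show ?thesis
      using True xs unfolding frontier_trees_def by simp
  next
    case False
    have "quotient_trees {0..<Suc n} (frontier_label (Suc n) xs) (path_power_edges k n) = {}"
      unfolding V
    proof (rule quotient_trees_isolated[where w = 0])
      fix x assume "x \<in> {0..<n}"
      then have "n - 1 - x < m" if "\<not> x + m < n" using that by auto
      then have "frontier_label n as x \<noteq> Inr a"
        using False xs(2) unfolding frontier_label_def by (auto simp: in_set_conv_nth)
      then show "frontier_label (Suc n) xs x \<noteq> frontier_label (Suc n) xs n"
        using lab labn \<open>x \<in> {0..<n}\<close> by simp
    qed (use path_power_edges_pairs assms in auto)
    then show ?thesis using False xs by simp
  qed
qed

lemma card_quotient_trees_absorb:
  assumes "length xs = Suc m" "0 < m" "m \<le> n" "j \<le> m"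
  shows "card (quotient_trees {0..<Suc n} (frontier_label (Suc n) xs)
      (path_power_edges k n \<union> back_edges n j)) =
    (\<Sum>ys\<leftarrow>absorb j xs. frontier_trees k n ys)"
  using assms(1,4)
proof (induction j arbitrary: xs)
  case 0
  then show ?case
    using card_quotient_trees_drop[OF _ assms(2,3)] by (simp add: back_edges_def)
next
  case (Suc j)
  let ?c = "frontier_label (Suc n) xs" and ?E = "path_power_edges k n \<union> back_edges n j"
  let ?ys = "map (\<lambda>l. if l = xs ! Suc j then hd xs else l) xs"
  let ?V = "{0..<Suc n}"
  have xs0: "hd xs = xs ! 0" using Suc.prems(1) by (cases xs) auto
  have ends: "?c (n - Suc j) = Inr (xs ! Suc j)" "?c n = Inr (hd xs)"
    using Suc.prems assms(3) xs0 unfolding frontier_label_def by auto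
  \<comment> \<open>Contraction relabels the whole block of vertex \<open>n - Suc j\<close>, and this block lies within the
    frontier; so it amounts to relabelling the list.\<close>
  have merged: "merge ?c (n - Suc j) n = frontier_label (Suc n) ?ys"
  proof
    fix x
    show "merge ?c (n - Suc j) n x = frontier_label (Suc n) ?ys x"
    proof (cases "x + length xs < Suc n")
      case True
      then show ?thesis unfolding merge_def ends by (simp add: frontier_label_def)
    next
      case False
      then have "n - x < length xs" using Suc.prems(1) by linarith
      then show ?thesis
        using False unfolding merge_def ends by (simp add: frontier_label_def)
    qed
  qed
  have pairs: "?E \<subseteq> vertex_pairs ?V"
    using path_power_edges_pairs[of k n] vertex_pairs_mono[of "{0..<n}" ?V]
      back_edges_pairs[of j n] Suc.prems(2) assms(3) by auto
  have "card (quotient_trees ?V ?c (insert {n - Suc j, n} ?E)) =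
      card (quotient_trees ?V ?c ?E) +
      (if ?c (n - Suc j) = ?c n then 0 else card (quotient_trees ?V (merge ?c (n - Suc j) n) ?E))"
  proof (rule deletion_contraction[OF _ _ pairs])
    show "finite ?E" using finite_path_power_edges by (simp add: back_edges_def)
    show "{n - Suc j, n} \<notin> ?E" by (rule back_edge_fresh) (use Suc.prems assms(3) in simp)
  qed auto
  also have "card (quotient_trees ?V ?c ?E) = (\<Sum>ys\<leftarrow>absorb j xs. frontier_trees k n ys)"
    using Suc.IH[of xs] Suc.prems by simp
  also have "card (quotient_trees ?V (merge ?c (n - Suc j) n) ?E) =
      (\<Sum>ys\<leftarrow>absorb j ?ys. frontier_trees k n ys)"
    unfolding merged using Suc.IH[of ?ys] Suc.prems by simp
  finally show ?case
    unfolding back_edges_Suc ends by (auto simp: eq_commute)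
qed

text \<open>While \<open>n \<le> k\<close>, the new vertex is adjacent to all others, and the whole graph is the frontier.\<close>

lemma frontier_trees_grow:
  assumes "0 < n" "n \<le> k" "length xs = Suc n"
  shows "frontier_trees k (Suc n) xs = (\<Sum>ys\<leftarrow>absorb n xs. frontier_trees k n ys)"
  using card_quotient_trees_absorb[OF assms(3,1) order.refl order.refl, of k] assms
  unfolding frontier_trees_def[of k "Suc n"] path_power_edges_Suc by (simp add: min_absorb2)

text \<open>Removing vertex \<open>n\<close> brings vertex \<open>n - k\<close> into the frontier. Since nothing is identified with
it, it gets a fresh label \<open>a\<close>.\<close>

lemma frontier_trees_slide:
  assumes "0 < k" "k \<le> n" "length xs = k" "a \<notin> set xs"
  shows "frontier_trees k (Suc n) xs = (\<Sum>ys\<leftarrow>absorb k (xs @ [a]). frontier_trees k n ys)"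
proof -
  have old: "frontier_label (Suc n) (xs @ [a]) x = frontier_label (Suc n) xs x"
    if "x < Suc n" "x \<noteq> n - k" for x
    using that assms(2,3) unfolding frontier_label_def by (auto simp: nth_append)
  have new: "frontier_label (Suc n) (xs @ [a]) (n - k) = Inr a" "frontier_label (Suc n) xs (n - k) = Inl (n - k)"
    using assms(2,3) unfolding frontier_label_def by (auto simp: nth_append)
  have ne: "frontier_label (Suc n) xs x \<noteq> Inr a" "frontier_label (Suc n) xs x \<noteq> Inl (n - k)"
    if "x < Suc n" "x \<noteq> n - k" for x
    using that assms unfolding frontier_label_def by (auto simp: in_set_conv_nth)
  have "quotient_trees {0..<Suc n} (frontier_label (Suc n) xs) E =
      quotient_trees {0..<Suc n} (frontier_label (Suc n) (xs @ [a])) E" for E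
  proof (rule quotient_trees_cong)
    fix x y assume "x \<in> {0..<Suc n}" "y \<in> {0..<Suc n}"
    then show "frontier_label (Suc n) xs x = frontier_label (Suc n) xs y \<longleftrightarrow>
      frontier_label (Suc n) (xs @ [a]) x = frontier_label (Suc n) (xs @ [a]) y"
      using old[of x] old[of y] new ne[of x] ne[of y]
      by (cases "x = n - k"; cases "y = n - k") auto
  qed
  then show ?thesis
    using card_quotient_trees_absorb[of "xs @ [a]" k n k k] assms
    unfolding frontier_trees_def[of k "Suc n"] path_power_edges_Suc by (simp add: min_absorb1)
qed

lemma frontier_trees_one: "frontier_trees k (Suc 0) [a] = 1"
proof -
  have "path_power_edges k (Suc 0) = {}" unfolding path_power_edges_def by auto
  moreover have "joins {0 :: nat} c {}" for c :: "nat \<Rightarrow> nat + nat"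
    by (rule joinsI) simp
  ultimately have "quotient_trees {0..<Suc 0} (frontier_label (Suc 0) [a]) (path_power_edges k (Suc 0)) = {{}}"
    unfolding quotient_trees_def by auto
  then show ?thesis unfolding frontier_trees_def by simp
qed

text \<open>The first argument is one less than the number of vertices.\<close>

fun small_count :: "nat \<Rightarrow> nat list \<Rightarrow> nat" where
  "small_count 0 xs = 1"
| "small_count (Suc n) xs = (\<Sum>ys\<leftarrow>absorb (Suc n) xs. small_count n ys)"

lemma frontier_trees_eq_small_count:
  assumes "n \<le> k" "length xs = Suc n"
  shows "frontier_trees k (Suc n) xs = small_count n xs"
  using assms
proof (induction n arbitrary: xs)
  case 0
  then obtain a where "xs = [a]" by (auto simp: length_Suc_conv)
  then show ?case by (simp add: frontier_trees_one)
next
  case (Suc n)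
  have "frontier_trees k (Suc (Suc n)) xs =
      (\<Sum>ys\<leftarrow>absorb (Suc n) xs. frontier_trees k (Suc n) ys)"
    by (rule frontier_trees_grow) (use Suc.prems in auto)
  also have "\<dots> = (\<Sum>ys\<leftarrow>absorb (Suc n) xs. small_count n ys)"
    using Suc.IH Suc.prems length_absorb[of _ "Suc n" xs]
    by (intro arg_cong[of _ _ sum_list] map_cong refl) simp
  finally show ?case by simp
qed

section \<open>The transfer matrix for the fourth power\<close>

text \<open>All set partitions of four vertices in normal form, from singletons to a single block.\<close>

definition frontier_states :: "nat list list" where
  "frontier_states =
    [[0, 1, 2, 3],
     [0, 0, 2, 3], [0, 1, 0, 3], [0, 1, 1, 3], [0, 1, 2, 0], [0, 1, 2, 1], [0, 1, 2, 2],
     [0, 0, 0, 3], [0, 0, 2, 0], [0, 0, 2, 2], [0, 1, 0, 0], [0, 1, 0, 1], [0, 1, 1, 0], [0, 1, 1, 1],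
     [0, 0, 0, 0]]"

definition transfer_matrix :: "int list list" where
  "transfer_matrix =
    [[4, 1, 1, 1, 1, 1, 1, 1, 1, 0, 1, 0, 0, 1, 1],
     [1, 1, 1, 0, 1, 0, 0, 1, 1, 0, 1, 0, 0, 0, 1],
     [1, 1, 0, 1, 0, 1, 0, 1, 1, 0, 0, 0, 0, 1, 1],
     [0, 4, 0, 0, 0, 0, 0, 2, 2, 1, 0, 0, 0, 0, 2],
     [1, 0, 1, 1, 0, 0, 1, 1, 0, 0, 1, 0, 0, 1, 1],
     [0, 0, 4, 0, 0, 0, 0, 2, 0, 0, 2, 1, 0, 0, 2],
     [0, 0, 0, 4, 0, 0, 0, 2, 0, 0, 0, 0, 1, 2, 2],
     [0, 1, 0, 0, 0, 0, 0, 1, 1, 0, 0, 0, 0, 0, 1],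
     [0, 0, 1, 0, 0, 0, 0, 1, 0, 0, 1, 0, 0, 0, 1],
     [0, 0, 0, 1, 0, 0, 0, 2, 0, 0, 0, 0, 1, 0, 2],
     [0, 0, 0, 1, 0, 0, 0, 1, 0, 0, 0, 0, 0, 1, 1],
     [0, 0, 1, 0, 0, 0, 0, 2, 0, 0, 0, 1, 0, 0, 2],
     [0, 1, 0, 0, 0, 0, 0, 2, 0, 1, 0, 0, 0, 0, 2],
     [0, 0, 0, 0, 0, 0, 0, 4, 0, 0, 0, 0, 0, 0, 3],
     [0, 0, 0, 0, 0, 0, 0, 1, 0, 0, 0, 0, 0, 0, 1]]"

lemma transfer_matrix_eq:
  "transfer_matrix = map (\<lambda>xs. map (\<lambda>q. int (count_list (absorb 4 (xs @ [4])) q)) frontier_states) frontier_states"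
  by code_simp

lemma absorb_frontier_states: "\<forall>xs\<in>set frontier_states. \<forall>ys\<in>set (absorb 4 (xs @ [4])). ys \<in> set frontier_states"
  by code_simp

lemma frontier_states_valid: "\<forall>xs\<in>set frontier_states. length xs = 4 \<and> 4 \<notin> set xs" "distinct frontier_states"
  unfolding frontier_states_def by simp_all

definition dot :: "int list \<Rightarrow> int list \<Rightarrow> int" where
  "dot r v = sum_list (map2 (*) r v)"

text \<open>The product of a row vector with a matrix whose rows have length \<open>N\<close>.\<close>

fun combine :: "nat \<Rightarrow> int list \<Rightarrow> int list list \<Rightarrow> int list" where
  "combine N (c # r) (row # M) = map2 (\<lambda>x y. c * x + y) row (combine N r M)"
| "combine N _ _ = replicate N 0"

lemma dot_Nil [simp]: "dot [] v = 0" "dot r [] = 0"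
  and dot_Cons [simp]: "dot (c # r) (x # v) = c * x + dot r v"
  by (simp_all add: dot_def)

lemma dot_zero: "dot (replicate N 0) v = 0"
proof (induction N arbitrary: v)
  case (Suc N)
  then show ?case by (cases v) auto
qed simp

lemma dot_linear:
  assumes "length xs = length v" "length ys = length v"
  shows "dot (map2 (\<lambda>x y. c * x + y) xs ys) v = c * dot xs v + dot ys v"
  using assms
proof (induction v arbitrary: xs ys)
  case (Cons a v)
  then show ?case by (cases xs; cases ys) (auto simp: algebra_simps)
qed simp

lemma length_combine:
  "\<forall>row\<in>set M. length row = N \<Longrightarrow> length (combine N r M) = N"
  by (induction N r M rule: combine.induct) auto

lemma dot_combine:
  assumes "\<forall>row\<in>set M. length row = length v"
  shows "dot (combine (length v) r M) v = dot r (map (\<lambda>row. dot row v) M)"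
  using assms
proof (induction r arbitrary: M)
  case (Cons c r)
  then show ?case
    by (cases M) (auto simp: dot_zero dot_linear length_combine)
qed (simp add: dot_zero)

definition state_vector :: "nat \<Rightarrow> int list" where
  "state_vector n = map (\<lambda>xs. int (frontier_trees 4 n xs)) frontier_states"

lemma length_state_vector [simp]: "length (state_vector n) = 15"
  by (simp add: state_vector_def frontier_states_def)

lemma sum_list_map_count:
  assumes "set zs \<subseteq> set qs" "distinct qs"
  shows "(\<Sum>z\<leftarrow>zs. h z) = dot (map (\<lambda>q. int (count_list zs q)) qs) (map h qs)"
proof -
  have "dot (map (\<lambda>q. int (count_list zs q)) qs) (map h qs) = (\<Sum>q\<leftarrow>qs. int (count_list zs q) * h q)"
    by (induction qs) auto
  also have "\<dots> = (\<Sum>q\<in>set qs. int (count_list zs q) * h q)"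
    using assms(2) by (simp add: sum_list_distinct_conv_sum_set)
  also have "\<dots> = (\<Sum>z\<leftarrow>zs. h z)"
    using assms(1)
  proof (induction zs)
    case (Cons z zs)
    have "(\<Sum>q\<in>set qs. int (count_list (z # zs) q) * h q) =
        (\<Sum>q\<in>set qs. (if q = z then h q else 0) + int (count_list zs q) * h q)"
      by (intro sum.cong) (auto simp: algebra_simps)
    then show ?case using Cons by (simp add: sum.distrib sum.delta)
  qed simp
  finally show ?thesis by simp
qed

lemma state_vector_Suc:
  assumes "4 \<le> n"
  shows "state_vector (Suc n) = map (\<lambda>row. dot row (state_vector n)) transfer_matrix"
proof -
  have of_nat_sum: "int (\<Sum>z\<leftarrow>zs. f z) = (\<Sum>z\<leftarrow>zs. int (f z))" for f and zs :: "nat list list"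
    by (induction zs) simp_all
  have "int (frontier_trees 4 (Suc n) xs) =
      dot (map (\<lambda>q. int (count_list (absorb 4 (xs @ [4])) q)) frontier_states) (state_vector n)"
    if xs: "xs \<in> set frontier_states" for xs
  proof -
    have "int (frontier_trees 4 (Suc n) xs) =
        (\<Sum>ys\<leftarrow>absorb 4 (xs @ [4]). int (frontier_trees 4 n ys))"
      using frontier_trees_slide[of 4 n xs 4] assms xs frontier_states_valid(1)
      by (simp add: of_nat_sum)
    also have "\<dots> = dot (map (\<lambda>q. int (count_list (absorb 4 (xs @ [4])) q)) frontier_states) (state_vector n)"
      unfolding state_vector_def
      by (rule sum_list_map_count) (use absorb_frontier_states xs frontier_states_valid(2) in auto)
    finally show ?thesis .
  qed
  then show ?thesis
    unfolding transfer_matrix_eq state_vector_def[of "Suc n"] by simp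
qed

lemma transfer_rows: "\<forall>row\<in>set transfer_matrix. length row = 15"
  by (simp add: transfer_matrix_def)

lemma dot_combine_transfer:
  assumes "4 \<le> n"
  shows "dot (combine 15 r transfer_matrix) (state_vector n) = dot r (state_vector (Suc n))"
  using dot_combine[of transfer_matrix "state_vector n" r] transfer_rows
  unfolding state_vector_Suc[OF assms] by simp

text \<open>The products of \<open>r\<close> with the powers of the transfer matrix. Pairing them with the state vector at \<open>n\<close> gives the
value of \<open>r\<close> at \<open>n, n + 1, \<dots>\<close>, so that a linear dependency between these rows is a recurrence
valid for all \<open>n\<close>.\<close>

fun orbit :: "nat \<Rightarrow> int list \<Rightarrow> int list list" where
  "orbit 0 r = []"
| "orbit (Suc m) r = r # orbit m (combine 15 r transfer_matrix)"

lemma dot_orbit: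
  assumes "4 \<le> n"
  shows "map (\<lambda>row. dot row (state_vector n)) (orbit m r) =
    map (\<lambda>i. dot r (state_vector (n + i))) [0..<m]"
proof (induction m arbitrary: r)
  case (Suc m)
  have "map (\<lambda>row. dot row (state_vector n)) (orbit (Suc m) r) =
      dot r (state_vector n) # map (\<lambda>i. dot r (state_vector (Suc (n + i)))) [0..<m]"
    using Suc[of "combine 15 r transfer_matrix"] dot_combine_transfer assms by simp
  also have "\<dots> = map (\<lambda>i. dot r (state_vector (n + i))) (0 # map Suc [0..<m])"
    by simp
  finally show ?case
    by (simp only: map_Suc_upt upt_conv_Cons zero_less_Suc)
qed simp

lemma orbit_rows: "length r = 15 \<Longrightarrow> \<forall>row\<in>set (orbit m r). length row = 15"
proof (induction m arbitrary: r)
  case (Suc m)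
  show ?case
    using Suc.IH[OF length_combine[OF transfer_rows], of r] Suc.prems by simp
qed simp

definition discrete_row :: "int list" where
  "discrete_row = [1, 0, 0, 0, 0, 0, 0, 0, 0, 0, 0, 0, 0, 0, 0]"

text \<open>The sum over the partitions of type 2+2 minus the sum over those of type 3+1.\<close>

definition balance_row :: "int list" where
  "balance_row = [0, 0, 0, 0, 0, 0, 0, -1, -1, 1, -1, 1, 1, -1, 0]"

text \<open>The coefficients of the expanded denominator. They form a palindrome, and so serve both as its power
series coefficients and as the coefficients of the recurrence, where the order is reversed.\<close>

definition recurrence :: "int list" where
  "recurrence = [1, -7, 1, 25, -31, 52, 84, -300, 84, 52, -31, 25, 1, -7, 1]"

lemma balance_row_invariant: "combine 15 balance_row transfer_matrix = balance_row"
  by code_simp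

text \<open>The order 14 is smaller than the number of partitions, so the recurrence need not hold for
arbitrary vectors that evolve by the transfer matrix; the obstruction is a multiple of the balance.\<close>

lemma recurrence_orbit:
  "combine 15 recurrence (orbit 15 discrete_row) = map (\<lambda>x. 50 * x) balance_row"
  by code_simp

lemma state_vector_4: "state_vector 4 = [16, 8, 8, 8, 8, 8, 8, 3, 3, 4, 3, 4, 4, 3, 1]"
proof -
  have "state_vector 4 = map (\<lambda>xs. int (small_count 3 xs)) frontier_states"
    unfolding state_vector_def
    using frontier_trees_eq_small_count[of 3 4] frontier_states_valid(1) by simp
  also have "\<dots> = [16, 8, 8, 8, 8, 8, 8, 3, 3, 4, 3, 4, 4, 3, 1]"
    by code_simp
  finally show ?thesis .
qed

lemma dot_discrete_row:
  "dot discrete_row (state_vector n) = int (frontier_trees 4 n [0, 1, 2, 3])"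
  unfolding discrete_row_def state_vector_def frontier_states_def by simp

definition path_trees :: "nat \<Rightarrow> int" where
  "path_trees n = int (num_spanning_trees (graph_power (path_graph n) 4))"

lemma path_trees_eq_dot:
  assumes "4 \<le> n"
  shows "path_trees n = dot discrete_row (state_vector n)"
  using num_spanning_trees_path_power[of n 4 4] assms
  unfolding path_trees_def dot_discrete_row by (simp add: upt_rec numeral_eq_Suc)

lemma path_trees_orbit:
  assumes "4 \<le> n"
  shows "map (\<lambda>i. path_trees (n + i)) [0..<m] =
    map (\<lambda>row. dot row (state_vector n)) (orbit m discrete_row)"
  using assms by (simp add: dot_orbit path_trees_eq_dot)

text \<open>The balance is the same for all \<open>n\<close>, and it is \<open>(4 + 4 + 4) - (3 + 3 + 3 + 3)\<close> at the complete graph on four vertices.\<close>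

lemma balance_zero:
  assumes "4 \<le> n"
  shows "dot balance_row (state_vector n) = 0"
  using assms
proof (induction n rule: dec_induct)
  case base
  show ?case unfolding state_vector_4 balance_row_def by simp
next
  case (step n)
  then show ?case
    using dot_combine_transfer[of n balance_row] by (simp add: balance_row_invariant)
qed

lemma dot_scale: "dot (map (\<lambda>x. a * x) r) v = a * dot r v"
proof (induction r arbitrary: v)
  case (Cons c r)
  then show ?case by (cases v) (auto simp: algebra_simps)
qed simp

lemma path_trees_recurrence:
  assumes "4 \<le> n"
  shows "dot recurrence (map (\<lambda>i. path_trees (n + i)) [0..<15]) = 0"
proof -
  have "dot recurrence (map (\<lambda>row. dot row (state_vector n)) (orbit 15 discrete_row)) =
      dot (combine 15 recurrence (orbit 15 discrete_row)) (state_vector n)"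
    using dot_combine[of "orbit 15 discrete_row" "state_vector n" recurrence]
      orbit_rows[of discrete_row 15] by (simp add: discrete_row_def)
  also have "\<dots> = 0"
    unfolding recurrence_orbit dot_scale using balance_zero[OF assms] by simp
  finally show ?thesis
    unfolding path_trees_orbit[OF assms] .
qed

section \<open>The generating function\<close>

definition initial_counts :: "int list" where
  "initial_counts =
    [864, 5635, 35840, 226080, 1424736, 8975232, 56531412, 356045600, 2242419040,
     14122994787, 88948032416, 560203336285, 3528214538112, 22221034368624]"

lemma path_trees_initial:
  assumes "m < 14"
  shows "path_trees (m + 6) = initial_counts ! m"
proof -
  \<comment> \<open>The state vector is known at four vertices, so the counts 16 and 125 of \<open>K\<^sub>4\<close> and \<open>K\<^sub>5\<close> come first.\<close>
  have "map (\<lambda>i. path_trees (4 + i)) [0..<16] = 16 # 125 # initial_counts"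
    unfolding path_trees_orbit[OF order.refl] state_vector_4 initial_counts_def by code_simp
  then have "map (\<lambda>i. path_trees (4 + i)) [0..<16] ! Suc (Suc m) = initial_counts ! m"
    by simp
  then show ?thesis
    using assms by (simp add: add.commute)
qed

definition numerator :: "int list" where
  "numerator = [864, -413, -2741, 2435, -7893, -5597, 36080, -11312, -5968, 3475, -3141, -13, 859, -125]"

lemma convolution_initial:
  "map (\<lambda>k. \<Sum>i\<leftarrow>[0..<15]. if k < i then 0 else recurrence ! i * initial_counts ! (k - i)) [0..<14] =
    numerator"
  by code_simp

text \<open>The coefficients of the generating function times the denominator: below \<open>t\<^sup>1\<^sup>4\<close> they involve initial
counts only, and from there on they are instances of the recurrence, read backwards.\<close>

lemma path_trees_convolution:
  "(\<Sum>i<15. if k < i then 0 else recurrence ! i * path_trees (k - i + 6)) =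
    (if k < 14 then numerator ! k else 0)"
proof (cases "k < 14")
  case True
  have "(\<Sum>i<15. if k < i then 0 else recurrence ! i * path_trees (k - i + 6)) =
      (\<Sum>i\<leftarrow>[0..<15]. if k < i then 0 else recurrence ! i * initial_counts ! (k - i))"
    unfolding interv_sum_list_conv_sum_set_nat set_upt atLeast0LessThan
  proof (rule sum.cong)
    fix i
    show "(if k < i then 0 else recurrence ! i * path_trees (k - i + 6)) =
        (if k < i then 0 else recurrence ! i * initial_counts ! (k - i))"
      by (subst path_trees_initial) (use True in simp_all)
  qed simp
  also have "\<dots> = numerator ! k"
    unfolding convolution_initial[symmetric] using True by (subst nth_map_upt) (simp_all only: add_0 diff_zero)
  finally show ?thesis using True by simp
next
  case False
  then obtain m where k: "k = m + 14"
    by (metis add.commute le_Suc_ex not_less)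
  have "(\<Sum>i<15. if k < i then 0 else recurrence ! i * path_trees (k - i + 6)) =
      (\<Sum>i<15. recurrence ! i * path_trees (m + 6 + (14 - i)))"
    by (rule sum.cong) (auto simp: k)
  also have "\<dots> = dot recurrence (map (\<lambda>i. path_trees (m + 6 + i)) [0..<15])"
    unfolding recurrence_def by (simp add: lessThan_Suc eval_nat_numeral upt_rec)
  also have "\<dots> = 0" by (rule path_trees_recurrence) simp
  finally show ?thesis using k by simp
qed

lemma fps_mult_coeff_list:
  fixes A :: "'a :: comm_ring_1 fps"
  shows "fps_nth (A * (\<Sum>i<m. fps_const (c i) * fps_X ^ i)) k =
    (\<Sum>i<m. if k < i then 0 else c i * fps_nth A (k - i))"
proof -
  have "A * (\<Sum>i<m. fps_const (c i) * fps_X ^ i) = (\<Sum>i<m. fps_const (c i) * (A * fps_X ^ i))"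
    by (simp add: sum_distrib_left algebra_simps)
  then show ?thesis
    by (simp add: fps_sum_nth fps_X_power_mult_right_nth if_distrib cong: if_cong)
qed

lemma fps_eq_divideI:
  fixes A :: "'a :: field fps"
  assumes "A * D = M" "D \<noteq> 0"
  shows "A = M / D"
  using fps_divide_times_eq[OF assms(2), of A] assms(1) by simp

theorem theorem6p1p3:
  fixes t :: "rat fps"
  defines "t \<equiv> fps_X"
  shows "Abs_fps (\<lambda>m. of_nat (num_spanning_trees (graph_power (path_graph (m + 6)) 4))) =
    (- 125 * t^13 + 859 * t^12 - 13 * t^11 - 3141 * t^10 + 3475 * t^9 - 5968 * t^8 - 11312 * t^7
      + 36080 * t^6 - 5597 * t^5 - 7893 * t^4 + 2435 * t^3 - 2741 * t^2 - 413 * t + 864) /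
    ((t^6 - 3 * t^5 + 6 * t^4 - 10 * t^3 + 6 * t^2 - 3 * t + 1) *
     (t^8 - 4 * t^7 - 17 * t^6 + 8 * t^5 + 49 * t^4 + 8 * t^3 - 17 * t^2 - 4 * t + 1))"
  (is "?A = ?M / ?D")
proof -
  have D: "?D = (\<Sum>i<15. fps_const (of_int (recurrence ! i)) * t ^ i)"
  proof -
    have "?D = t^14 - 7 * t^13 + t^12 + 25 * t^11 - 31 * t^10 + 52 * t^9 + 84 * t^8 - 300 * t^7
      + 84 * t^6 + 52 * t^5 - 31 * t^4 + 25 * t^3 + t^2 - 7 * t + 1"
      by algebra
    also have "\<dots> = (\<Sum>i<15. fps_const (of_int (recurrence ! i)) * t ^ i)"
      unfolding recurrence_def by (simp add: eval_nat_numeral numeral_fps_const flip: fps_const_neg)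
    finally show ?thesis .
  qed
  have M: "?M = (\<Sum>i<14. fps_const (of_int (numerator ! i)) * t ^ i)"
    unfolding numerator_def by (simp add: eval_nat_numeral numeral_fps_const flip: fps_const_neg)
  have A: "?A = Abs_fps (\<lambda>m. of_int (path_trees (m + 6)))"
    by (simp add: path_trees_def)
  have conv: "(\<Sum>i<15. if k < i then 0 else of_int (recurrence ! i) * of_int (path_trees (k - i + 6))) =
      (of_int (if k < 14 then numerator ! k else 0) :: rat)" for k
    unfolding path_trees_convolution[symmetric] of_int_sum by (rule sum.cong) simp_all
  have "?A * ?D = ?M"
  proof (rule fps_ext)
    fix k
    have "fps_nth ?M k = fps_nth (1 * (\<Sum>i<14. fps_const (of_int (numerator ! i)) * t ^ i)) k"
      unfolding M by simp
    also have "\<dots> = of_int (if k < 14 then numerator ! k else 0)"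
      unfolding t_def fps_mult_coeff_list
      by (subst sum.mono_neutral_cong_right[of _ "{k} \<inter> {..<14}"]) auto
    also have "\<dots> = fps_nth (?A * ?D) k"
      unfolding A D unfolding t_def fps_mult_coeff_list fps_nth_Abs_fps by (rule conv[symmetric])
    finally show "fps_nth (?A * ?D) k = fps_nth ?M k" ..
  qed
  moreover have "?D \<noteq> 0"
  proof
    assume "?D = 0"
    then have "fps_nth ?D 0 = 0" by (simp only: fps_zero_nth)
    then show False unfolding t_def by simp
  qed
  ultimately show ?thesis by (rule fps_eq_divideI)
qed

end
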